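(* Let $N\ge 2$ and let $\Phi:C\to\mathbb{R}$ be a $2$-box monotone convex function defined on an open box $C\subset\mathbb{R}^{N}$. Then on every compact box $K\subset C$, $\Phi$ is the uniform limit of a sequence $(\Phi_n)_n$ of infinitely differentiable strongly convex functions with isotone differentials. When $C\subset\mathbb{R}_{++}^{N}$ and the function $\Phi$ is also isotone, the approximants $\Phi_{n}$ can be chosen to be isotone.
   Context: $\mathbb{R}^N$ carries the Euclidean norm and the coordinatewise order: $\mathbf{x}\le\mathbf{y}$ iff $x_k\le y_k$ for all $k$; $\mathbb{R}_{++}^{N}=\{\mathbf{x}: x_1,\dots,x_N>0\}$. An open box is a product $\prod_{k=1}^N(a_k,b_k)$ of $N$ open intervals; a compact box is a product of $N$ compact intervals. A real-valued function $\Phi$ on $C$ is $2$-box monotone if for all indices $1\le i<j\le N$ and every nondegenerate $2$-dimensional box contained in $C$ of the form $B_{ij}=\{u_1\}\times\cdots\times[v_i,w_i]\times\cdots\times[v_j,w_j]\times\cdots\times\{u_N\}$ (intervals in the $i$th and $j$th positions, with $v_i<w_i$, $v_j<w_j$, and singletons elsewhere) one has $$\Phi(u_1,\dots,v_i,\dots,v_j,\dots,u_N)-\Phi(u_1,\dots,v_i,\dots,w_j,\dots,u_N)-\Phi(u_1,\dots,w_i,\dots,v_j,\dots,u_N)+\Phi(u_1,\dots,w_i,\dots,w_j,\dots,u_N)\ge 0.$$ A real-valued function $\Psi$ on a convex set is strongly convex if $\Psi-(\alpha/2)\|\cdot\|^2$ is convex for some $\alpha>0$. A real-valued function $\Psi$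 is isotone if $\mathbf{x}\le\mathbf{y}$ implies $\Psi(\mathbf{x})\le\Psi(\mathbf{y})$; its differential is isotone if $\mathbf{x}\le\mathbf{y}$ implies $\frac{\partial\Psi}{\partial x_k}(\mathbf{x})\le\frac{\partial\Psi}{\partial x_k}(\mathbf{y})$ for all $k$. The properties of the approximants are understood on $K$. *)

theory Defs
  imports "HOL-Analysis.Analysis"
begin

text \<open>Products of open intervals; the extended-real endpoints admit unbounded intervals,
  so that for instance the open positive orthant is an open box.\<close>

definition open_box :: "(real^'n) set \<Rightarrow> bool" where
  "open_box C \<longleftrightarrow> (\<exists>a b :: 'n \<Rightarrow> ereal. (\<forall>k. a k < b k) \<and>
     C = {x. \<forall>k. a k < ereal (x $ k) \<and> ereal (x $ k) < b k})"

definition set2 :: "real^'n \<Rightarrow> 'n \<Rightarrow> real \<Rightarrow> 'n \<Rightarrow> real \<Rightarrow> real^'n" where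
  "set2 u i s j t = (\<chi> k. if k = i then s else if k = j then t else u $ k)"

text \<open>The index type carries no order. The condition below is symmetric in the two
  indices, so quantifying over distinct pairs amounts to quantifying over pairs
  with i < j for any enumeration of the coordinates.\<close>

definition two_box_monotone_on :: "(real^'n) set \<Rightarrow> (real^'n \<Rightarrow> real) \<Rightarrow> bool" where
  "two_box_monotone_on C \<Phi> \<longleftrightarrow>
     (\<forall>i j u v\<^sub>i w\<^sub>i v\<^sub>j w\<^sub>j. i \<noteq> j \<longrightarrow> v\<^sub>i < w\<^sub>i \<longrightarrow> v\<^sub>j < w\<^sub>j \<longrightarrow>
        {set2 u i s j t | s t. s \<in> {v\<^sub>i..w\<^sub>i} \<and> t \<in> {v\<^sub>j..w\<^sub>j}} \<subseteq> C \<longrightarrow>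
        \<Phi> (set2 u i v\<^sub>i j v\<^sub>j) - \<Phi> (set2 u i v\<^sub>i j w\<^sub>j)
          - \<Phi> (set2 u i w\<^sub>i j v\<^sub>j) + \<Phi> (set2 u i w\<^sub>i j w\<^sub>j) \<ge> 0)"

definition strongly_convex_on :: "'a::real_normed_vector set \<Rightarrow> ('a \<Rightarrow> real) \<Rightarrow> bool" where
  "strongly_convex_on S \<Psi> \<longleftrightarrow> (\<exists>\<alpha>>0. convex_on S (\<lambda>x. \<Psi> x - (\<alpha> / 2) * (norm x)\<^sup>2))"

definition partial_deriv :: "'n \<Rightarrow> (real^'n \<Rightarrow> real) \<Rightarrow> real^'n \<Rightarrow> real" where
  "partial_deriv k \<Psi> x = frechet_derivative \<Psi> (at x) (axis k 1)"

definition isotone_differential_on :: "(real^'n) set \<Rightarrow> (real^'n \<Rightarrow> real) \<Rightarrow> bool" where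
  "isotone_differential_on S \<Psi> \<longleftrightarrow>
     (\<forall>x\<in>S. \<Psi> differentiable (at x)) \<and> (\<forall>k. mono_on S (partial_deriv k \<Psi>))"

text \<open>Continuous differentiability of order m; meant for open sets, since the
  derivatives are taken in the full space.\<close>

primrec C_diff_on :: "nat \<Rightarrow> (real^'n) set \<Rightarrow> (real^'n \<Rightarrow> real) \<Rightarrow> bool" where
  "C_diff_on 0 U \<Psi> \<longleftrightarrow> continuous_on U \<Psi>"
| "C_diff_on (Suc m) U \<Psi> \<longleftrightarrow>
     (\<forall>x\<in>U. \<Psi> differentiable (at x)) \<and> (\<forall>k. C_diff_on m U (partial_deriv k \<Psi>))"

text \<open>Infinite differentiability on an arbitrary set: on some open neighbourhood of it.\<close>

definition smooth_on :: "(real^'n) set \<Rightarrow> (real^'n \<Rightarrow> real) \<Rightarrow> bool" where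
  "smooth_on S \<Psi> \<longleftrightarrow> (\<exists>U. open U \<and> S \<subseteq> U \<and> (\<forall>m. C_diff_on m U \<Psi>))"

end

theory Submission
  imports Defs
begin

text \<open>Averaging translates preserves every hypothesis. Let \<open>\<eta>\<close> be a smooth probability density on
  the cube \<open>[-1,1]\<^sup>N\<close> and let \<open>g x\<close> be the mean of \<open>\<Phi> (x - \<epsilon> z)\<close> with respect to \<open>\<eta> z\<close>. Convexity,
  isotonicity and box monotonicity of \<open>\<Phi>\<close> are linear inequalities between values of \<open>\<Phi>\<close> that
  hold at every translate inside the domain, so \<open>g\<close> inherits them as soon as \<open>\<epsilon>\<close> is smaller than
  the distance from the compact box to the complement of the domain. Uniform continuity makes \<open>g\<close>
  close to \<open>\<Phi>\<close>, and adding \<open>(\<alpha>/2) \<parallel>x\<parallel>\<^sup>2\<close> with a small \<open>\<alpha>\<close> makes it strongly convex. The square of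
  the norm has an isotone differential everywhere, and is itself isotone on the positive orthant;
  this is where the second part needs a domain with positive coordinates.

  Smoothness of \<open>g\<close> comes from its other form, a convolution of \<open>\<Phi>\<close> with a product of
  one-variable bumps: differentiating under the integral replaces one factor by its derivative,
  so the class of such convolutions is closed under partial derivatives
  (\<open>C_diff_on_box_conv\<close>). The lemma \<open>smooth_bump_average\<close> identifies the two forms.

  Isotonicity of the differential is read off from increments. Box monotonicity makes
  \<open>\<Phi> (x + t e\<^sub>k) - \<Phi> x\<close> increasing in every coordinate other than the \<open>k\<close>th, and convexity makes it
  increasing in the \<open>k\<close>th; together it is isotone in \<open>x\<close> (\<open>increment_mono\<close>). This linear inequality
  passes to \<open>g\<close>, and on dividing by \<open>t\<close> and letting \<open>t\<close> tend to \<open>0\<close> from the right it becomes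
  monotonicity of the partial derivatives (\<open>isotone_differential_onI\<close>).\<close>

section \<open>A smooth bump on the line\<close>

text \<open>Finite orders of differentiability are what products of functions respect by a direct
  induction; smoothness is then the statement for all orders.\<close>

primrec times_differentiable :: "nat \<Rightarrow> (real \<Rightarrow> real) \<Rightarrow> bool" where
  "times_differentiable 0 f \<longleftrightarrow> continuous_on UNIV f"
| "times_differentiable (Suc m) f \<longleftrightarrow>
     (\<exists>f'. (\<forall>x. (f has_real_derivative f' x) (at x)) \<and> times_differentiable m f')"

lemma times_differentiable_continuous:
  assumes "times_differentiable m f"
  shows "continuous_on UNIV f"
  using assms by (cases m) (auto intro: DERIV_continuous_on has_field_derivative_at_within)

lemma times_differentiable_SucD:
  "times_differentiable (Suc m) f \<Longrightarrow> times_differentiable m f"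
proof (induction m arbitrary: f)
  case 0
  then show ?case by (metis times_differentiable.simps(1) times_differentiable_continuous)
next
  case (Suc m)
  then show ?case by (metis times_differentiable.simps(2))
qed

lemma times_differentiable_const: "times_differentiable m (\<lambda>x. c)"
  by (induction m arbitrary: c) (auto intro!: exI[of _ "\<lambda>x. 0"] derivative_eq_intros)

lemma times_differentiable_add:
  "times_differentiable m f \<Longrightarrow> times_differentiable m g \<Longrightarrow>
   times_differentiable m (\<lambda>x. f x + g x)"
proof (induction m arbitrary: f g)
  case 0
  then show ?case by (auto intro: continuous_intros)
next
  case (Suc m)
  then obtain f' g' where "\<And>x. (f has_real_derivative f' x) (at x)" "times_differentiable m f'"
    "\<And>x. (g has_real_derivative g' x) (at x)" "times_differentiable m g'"
    by auto
  with Suc.IH show ?case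
    by (auto intro!: exI[of _ "\<lambda>x. f' x + g' x"] DERIV_add)
qed

lemma times_differentiable_mult:
  "times_differentiable m f \<Longrightarrow> times_differentiable m g \<Longrightarrow>
   times_differentiable m (\<lambda>x. f x * g x)"
proof (induction m arbitrary: f g)
  case 0
  then show ?case by (auto intro: continuous_intros)
next
  case (Suc m)
  then obtain f' g' where *: "\<And>x. (f has_real_derivative f' x) (at x)" "times_differentiable m f'"
    "\<And>x. (g has_real_derivative g' x) (at x)" "times_differentiable m g'"
    by auto
  have "times_differentiable m (\<lambda>x. f' x * g x + g' x * f x)"
    using *(2,4) Suc.prems[THEN times_differentiable_SucD]
    by (intro times_differentiable_add Suc.IH)
  with *(1,3) show ?case
    unfolding times_differentiable.simps
    by (intro exI[of _ "\<lambda>x. f' x * g x + g' x * f x"]) (auto intro!: DERIV_mult)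
qed

lemma times_differentiable_affine:
  "times_differentiable m f \<Longrightarrow> times_differentiable m (\<lambda>x. f (s * x + t))"
proof (induction m arbitrary: f)
  case 0
  then have "continuous_on UNIV f" by simp
  then show ?case
    by (auto intro!: continuous_on_compose2[of UNIV f] continuous_intros)
next
  case (Suc m)
  then obtain f' where f': "\<And>x. (f has_real_derivative f' x) (at x)" "times_differentiable m f'"
    by auto
  have "((\<lambda>x. f (s * x + t)) has_real_derivative f' (s * x + t) * s) (at x)" for x
    by (rule DERIV_chain2[OF f'(1)]) (auto intro!: derivative_eq_intros)
  moreover have "times_differentiable m (\<lambda>x. f' (s * x + t) * s)"
    by (intro times_differentiable_mult times_differentiable_const Suc.IH f'(2))
  ultimately show ?case
    unfolding times_differentiable.simps by (intro exI[of _ "\<lambda>x. f' (s * x + t) * s"]) simp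
qed

text \<open>The derivative of \<open>exp (-1/x)\<close> is \<open>exp (-1/x)\<close> times a polynomial in \<open>1/x\<close>. Carrying
  the polynomial along makes the family closed under differentiation.\<close>

definition flat_exp :: "real poly \<Rightarrow> real \<Rightarrow> real" where
  "flat_exp p x = (if x > 0 then poly p (1 / x) * exp (- (1 / x)) else 0)"

lemma poly_times_exp_minus_tendsto_0: "((\<lambda>u. poly p u * exp (- u)) \<longlongrightarrow> (0::real)) at_top"
proof -
  have "((\<lambda>u. \<Sum>i\<le>degree p. coeff p i * (u ^ i / exp u)) \<longlongrightarrow> (\<Sum>i\<le>degree p. coeff p i * 0)) at_top"
    by (intro tendsto_intros tendsto_power_div_exp_0)
  then show ?thesis
    by (simp add: poly_altdef exp_minus field_simps sum_distrib_left sum_divide_distrib)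
qed

lemma flat_exp_tendsto_0: "(flat_exp p \<longlongrightarrow> 0) (at 0)"
proof -
  have "((\<lambda>x. poly p (inverse x) * exp (- inverse x)) \<longlongrightarrow> (0::real)) (at_right 0)"
    by (rule filterlim_compose[OF poly_times_exp_minus_tendsto_0 filterlim_inverse_at_top_right])
  moreover have "\<forall>\<^sub>F x in at_right 0. poly p (inverse x) * exp (- inverse x) = flat_exp p x"
    by (auto simp: flat_exp_def eventually_at_filter inverse_eq_divide)
  ultimately have "(flat_exp p \<longlongrightarrow> 0) (at_right 0)"
    using filterlim_cong by fastforce
  moreover have "\<forall>\<^sub>F x in at_left 0. 0 = flat_exp p x"
    by (auto simp: flat_exp_def eventually_at_filter)
  then have "(flat_exp p \<longlongrightarrow> 0) (at_left 0)"
    by (rule Lim_transform_eventually[OF tendsto_const])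
  ultimately show ?thesis by (simp add: filterlim_at_split)
qed

text \<open>The factor \<open>1/x\<^sup>2\<close> from the chain rule is the monomial; \<open>p - p'\<close> collects the derivatives of the
  exponential and of the polynomial.\<close>

lemma flat_exp_has_derivative:
  "(flat_exp p has_real_derivative flat_exp (monom 1 2 * (p - pderiv p)) x) (at x)"
proof -
  consider "x > 0" | "x < 0" | "x = 0" by linarith
  then show ?thesis
  proof cases
    case 1
    have "((\<lambda>x. poly p (1 / x) * exp (- (1 / x))) has_real_derivative
       flat_exp (monom 1 2 * (p - pderiv p)) x) (at x)"
      using 1 by (auto intro!: derivative_eq_intros DERIV_chain2[OF poly_DERIV]
          simp: flat_exp_def poly_monom field_simps power2_eq_square)
    then show ?thesis
      by (rule has_field_derivative_transform_within_open[of _ _ _ "{0<..}"])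
        (use 1 in \<open>auto simp: flat_exp_def\<close>)
  next
    case 2
    have "((\<lambda>x. 0) has_real_derivative flat_exp (monom 1 2 * (p - pderiv p)) x) (at x)"
      using 2 by (auto simp: flat_exp_def)
    then show ?thesis
      by (rule has_field_derivative_transform_within_open[of _ _ _ "{..<0}"])
        (use 2 in \<open>auto simp: flat_exp_def\<close>)
  next
    case 3
    \<comment> \<open>Division by \<open>x\<close> stays within the family: it multiplies the polynomial by its variable.\<close>
    have "(\<lambda>y. (flat_exp p y - flat_exp p 0) / (y - 0)) = flat_exp (pCons 0 p)"
      by (auto simp: flat_exp_def)
    with flat_exp_tendsto_0 3 show ?thesis
      by (simp add: has_field_derivative_iff) (simp add: flat_exp_def)
  qed
qed

lemma times_differentiable_flat_exp: "times_differentiable m (flat_exp p)"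
proof (induction m arbitrary: p)
  case 0
  show ?case by simp (rule DERIV_continuous_on, rule has_field_derivative_at_within, rule flat_exp_has_derivative)
next
  case (Suc m)
  then show ?case by (auto intro!: exI flat_exp_has_derivative)
qed

text \<open>A product of one flat function for each end of \<open>[-1,1]\<close>, so smoothness reduces to that of
  \<open>exp (-1/x)\<close> extended by zero.\<close>

definition bump :: "real \<Rightarrow> real" where
  "bump t = flat_exp 1 (1 + t) * flat_exp 1 (1 - t)"

lemma bump_nonneg: "0 \<le> bump t"
  by (simp add: bump_def flat_exp_def)

lemma bump_eq_0: "1 \<le> \<bar>t\<bar> \<Longrightarrow> bump t = 0"
  by (auto simp: bump_def flat_exp_def)

lemma bump_0_pos: "0 < bump 0"
  by (simp add: bump_def flat_exp_def)

lemma times_differentiable_bump: "times_differentiable m (\<lambda>t. bump (s * t))"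
  using times_differentiable_mult[OF
      times_differentiable_affine[OF times_differentiable_flat_exp[of m 1], of s 1]
      times_differentiable_affine[OF times_differentiable_flat_exp[of m 1], of "-s" 1]]
  by (simp add: bump_def add.commute)

section \<open>Convolution with product kernels\<close>

text \<open>The factors of the kernel are arbitrary functions indexed by the coordinates, rather than a
  single bump, because repeated partial derivatives differentiate different factors.\<close>

definition box_conv ::
    "real^'n \<Rightarrow> real^'n \<Rightarrow> (real^'n \<Rightarrow> real) \<Rightarrow> ('n \<Rightarrow> real \<Rightarrow> real) \<Rightarrow> real^'n \<Rightarrow> real" where
  "box_conv a b F f x = integral (cbox a b) (\<lambda>y. F y * (\<Prod>k\<in>UNIV. f k (x $ k - y $ k)))"

lemma continuous_on_product_kernel:
  fixes f :: "'n::finite \<Rightarrow> real \<Rightarrow> real" and F :: "real^'n \<Rightarrow> real"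
  assumes F: "continuous_on (cbox a b) F" and f: "\<And>k. continuous_on UNIV (f k)"
  shows "continuous_on (UNIV \<times> cbox a b) (\<lambda>(x, y). F y * (\<Prod>k\<in>I. f k (x $ k - y $ k)))"
proof -
  have "continuous_on S (\<lambda>z. f k (fst z $ k - snd z $ k))"
    for k and S :: "((real^'n) \<times> (real^'n)) set"
    by (rule continuous_on_compose2[OF f]) (auto intro!: continuous_intros)
  moreover have "continuous_on (UNIV \<times> cbox a b) (\<lambda>z::(real^'n) \<times> (real^'n). F (snd z))"
    by (rule continuous_on_compose2[OF F]) (auto intro!: continuous_intros)
  ultimately show ?thesis
    unfolding case_prod_beta by (intro continuous_intros)
qed

text \<open>Differentiation under the integral sign: each partial derivative of the kernel is
  again a product, with a single factor replaced by its derivative.\<close>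

lemma box_conv_has_derivative:
  fixes f :: "'n::finite \<Rightarrow> real \<Rightarrow> real" and F :: "real^'n \<Rightarrow> real"
  assumes F: "continuous_on (cbox a b) F"
    and f: "\<And>k t. (f k has_real_derivative f' k t) (at t)"
    and f': "\<And>k. continuous_on UNIV (f' k)"
  shows "\<exists>D. (box_conv a b F f has_derivative D) (at x) \<and>
             (\<forall>k. D (axis k 1) = box_conv a b F (f(k := f' k)) x)"
proof -
  have cf: "continuous_on UNIV (f k)" for k
    by (rule DERIV_continuous_on[OF has_field_derivative_at_within[OF f]])
  define G where "G k x y = F y * (\<Prod>j\<in>UNIV. (f(k := f' k)) j (x $ j - y $ j))" for k x y
  define fx where "fx x y = (\<Sum>k\<in>UNIV. G k x y *\<^sub>R blinfun_inner_right (axis k (1::real)))" for x y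
  have cG: "continuous_on (UNIV \<times> cbox a b) (\<lambda>(x, y). G k x y)" for k
    unfolding G_def by (rule continuous_on_product_kernel[OF F]) (use cf f' in auto)
  have cfx: "continuous_on (UNIV \<times> cbox a b) (\<lambda>(x, y). fx x y)"
    using cG unfolding fx_def case_prod_beta by (intro continuous_intros)
  have slice: "continuous_on (cbox a b) (h x)"
    if "continuous_on (UNIV \<times> cbox a b) (\<lambda>(x, y). h x y)" for h :: "real^'n \<Rightarrow> real^'n \<Rightarrow> 'c::banach" and x
    using continuous_on_compose2[OF that
        continuous_on_Pair[OF continuous_on_const continuous_on_id], of x]
    by auto
  have integrable: "(\<lambda>y. F y * (\<Prod>k\<in>UNIV. f k (x $ k - y $ k))) integrable_on cbox a b" for x
    by (rule integrable_continuous, rule slice, rule continuous_on_product_kernel[OF F cf])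
  have kernel_deriv: "((\<lambda>x. F y * (\<Prod>k\<in>UNIV. f k (x $ k - y $ k))) has_derivative blinfun_apply (fx x y)) (at x)"
    for x y
  proof -
    have "((\<lambda>x. f k (x $ k - y $ k)) has_derivative (\<lambda>h. h $ k * f' k (x $ k - y $ k))) (at x)" for k
    proof -
      have "((\<lambda>x. x $ k - y $ k) has_derivative (\<lambda>h. h $ k)) (at x)"
        by (auto intro!: derivative_eq_intros bounded_linear_imp_has_derivative bounded_linear_vec_nth)
      from has_derivative_compose[OF this f[of k, unfolded has_field_derivative_def]]
      show ?thesis by (simp add: mult.commute)
    qed
    then have "((\<lambda>x. \<Prod>k\<in>UNIV. f k (x $ k - y $ k)) has_derivative
        (\<lambda>h. \<Sum>k\<in>UNIV. h $ k * f' k (x $ k - y $ k) * (\<Prod>j\<in>UNIV - {k}. f j (x $ j - y $ j)))) (at x)"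
      by (intro has_derivative_prod)
    from has_derivative_mult_right[OF this, of "F y"]
    have *: "((\<lambda>x. F y * (\<Prod>k\<in>UNIV. f k (x $ k - y $ k))) has_derivative
        (\<lambda>h. F y * (\<Sum>k\<in>UNIV. h $ k * f' k (x $ k - y $ k) * (\<Prod>j\<in>UNIV - {k}. f j (x $ j - y $ j))))) (at x)" .
    have G: "G k x y = F y * (f' k (x $ k - y $ k) * (\<Prod>j\<in>UNIV - {k}. f j (x $ j - y $ j)))" for k
      unfolding G_def by (subst prod.remove[of _ k]) auto
    have "blinfun_apply (fx x y) h =
        F y * (\<Sum>k\<in>UNIV. h $ k * f' k (x $ k - y $ k) * (\<Prod>j\<in>UNIV - {k}. f j (x $ j - y $ j)))" for h
      unfolding fx_def G by (simp add: blinfun.sum_left blinfun.scaleR_left inner_axis'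
          sum_distrib_left algebra_simps)
    with * show ?thesis by presburger
  qed
  have "(box_conv a b F f has_derivative blinfun_apply (integral (cbox a b) (fx x))) (at x)"
    using leibniz_rule[of UNIV a b "\<lambda>x y. F y * (\<Prod>k\<in>UNIV. f k (x $ k - y $ k))" fx x,
        OF kernel_deriv integrable cfx]
    by (simp add: box_conv_def[abs_def])
  moreover have "blinfun_apply (integral (cbox a b) (fx x)) (axis k 1) = box_conv a b F (f(k := f' k)) x" for k
  proof -
    have "fx x integrable_on cbox a b"
      by (rule integrable_continuous, rule slice[OF cfx])
    moreover have "blinfun_apply (fx x y) (axis k 1) = G k x y" for y
      unfolding fx_def by (simp add: blinfun.sum_left blinfun.scaleR_left inner_axis')
        (simp add: axis_def if_distrib cong: if_cong)
    ultimately show ?thesis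
      by (simp add: blinfun_apply_integral box_conv_def G_def)
  qed
  ultimately show ?thesis by blast
qed

lemma C_diff_on_box_conv:
  fixes f :: "'n::finite \<Rightarrow> real \<Rightarrow> real" and F :: "real^'n \<Rightarrow> real"
  assumes F: "continuous_on (cbox a b) F"
  shows "(\<And>k. times_differentiable (Suc m) (f k)) \<Longrightarrow> C_diff_on m UNIV (box_conv a b F f)"
proof (induction m arbitrary: f)
  case (0 f)
  then have "\<forall>k. \<exists>f'. (\<forall>t. (f k has_real_derivative f' t) (at t)) \<and> continuous_on UNIV f'"
    by simp
  from choice[OF this] obtain f' where f': "\<And>k t. (f k has_real_derivative f' k t) (at t)"
    "\<And>k. continuous_on UNIV (f' k)"
    by blast
  have "isCont (box_conv a b F f) x" for x
    using box_conv_has_derivative[where f = f and f' = f' and x = x, OF F f'] has_derivative_continuous by blast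
  then show ?case
    by (simp add: continuous_at_imp_continuous_on)
next
  case (Suc m f)
  have "\<forall>k. \<exists>f'. (\<forall>t. (f k has_real_derivative f' t) (at t)) \<and> times_differentiable (Suc m) f'"
    using Suc.prems unfolding times_differentiable.simps(2)[of "Suc m"] by blast
  from choice[OF this] obtain f' where f': "\<And>k t. (f k has_real_derivative f' k t) (at t)"
    "\<And>k. times_differentiable (Suc m) (f' k)"
    by blast
  have D: "\<exists>D. (box_conv a b F f has_derivative D) (at x) \<and>
             (\<forall>k. D (axis k 1) = box_conv a b F (f(k := f' k)) x)" for x
    by (rule box_conv_has_derivative[OF F f'(1)]) (rule times_differentiable_continuous[OF f'(2)])
  have "partial_deriv k (box_conv a b F f) x = box_conv a b F (f(k := f' k)) x" for k x
    using D[of x] frechet_derivative_at[of "box_conv a b F f" _ x]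
    by (auto simp: partial_deriv_def)
  then have "partial_deriv k (box_conv a b F f) = box_conv a b F (f(k := f' k))" for k
    by blast
  moreover have "C_diff_on m UNIV (box_conv a b F (f(k := f' k)))" for k
    using f'(2) Suc.prems[THEN times_differentiable_SucD]
    by (intro Suc.IH) (simp del: times_differentiable.simps)
  moreover have "box_conv a b F f differentiable (at x)" for x
    using D[of x] unfolding differentiable_def by blast
  ultimately show ?case by simp
qed

section \<open>Averages against the bump kernel\<close>

definition bump_kernel :: "real^'n \<Rightarrow> real" where
  "bump_kernel z = (\<Prod>k\<in>UNIV. bump (z $ k))"

definition bump_average :: "(real^'n \<Rightarrow> real) \<Rightarrow> real" where
  "bump_average u = integral (cbox (-1) 1) (\<lambda>z. u z * bump_kernel z)
                    / integral (cbox (-1) 1) (bump_kernel :: real^'n \<Rightarrow> real)"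

lemma bump_kernel_nonneg: "0 \<le> bump_kernel z"
  by (simp add: bump_kernel_def prod_nonneg bump_nonneg)

lemma bump_kernel_eq_0:
  assumes "z \<notin> cbox (-1) 1"
  shows "bump_kernel z = 0"
proof -
  from assms obtain k where "\<not> (- 1 \<le> z $ k \<and> z $ k \<le> 1)"
    by (auto simp: mem_box_cart)
  then have "1 \<le> \<bar>z $ k\<bar>" by linarith
  then show ?thesis
    by (auto simp: bump_kernel_def intro!: exI[of _ k] bump_eq_0)
qed

lemma continuous_on_bump_kernel: "continuous_on S bump_kernel"
proof -
  have "continuous_on UNIV bump"
    using times_differentiable_bump[of 0 1] by simp
  then have "continuous_on S (\<lambda>z. bump (z $ k))" for k
    by (rule continuous_on_compose2) (auto intro!: continuous_intros)
  then show ?thesis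
    unfolding bump_kernel_def[abs_def] by (intro continuous_intros)
qed

lemma bump_kernel_mass_pos: "0 < integral (cbox (-1) 1) (bump_kernel :: real^'n \<Rightarrow> real)"
proof -
  have int: "(bump_kernel :: real^'n \<Rightarrow> real) integrable_on cbox (-1) 1"
    by (rule integrable_continuous[OF continuous_on_bump_kernel])
  have "integral (cbox (-1) 1) (bump_kernel :: real^'n \<Rightarrow> real) \<noteq> 0"
  proof
    assume "integral (cbox (-1) 1) (bump_kernel :: real^'n \<Rightarrow> real) = 0"
    with int have "((bump_kernel :: real^'n \<Rightarrow> real) has_integral 0) (cbox (-1) 1)"
      by (metis integrable_integral)
    then have "bump_kernel (0 :: real^'n) = 0"
      by (rule has_integral_0_cbox_imp_0[OF continuous_on_bump_kernel bump_kernel_nonneg])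
        (auto simp: mem_box_cart interval_eq_empty_cart)
    moreover have "bump_kernel (0 :: real^'n) > 0"
      by (simp add: bump_kernel_def bump_0_pos)
    ultimately show False by simp
  qed
  moreover have "0 \<le> integral (cbox (-1) 1) (bump_kernel :: real^'n \<Rightarrow> real)"
    by (rule integral_nonneg[OF int bump_kernel_nonneg])
  ultimately show ?thesis by simp
qed

lemma integrable_times_bump_kernel:
  "continuous_on (cbox (-1) 1) u \<Longrightarrow> (\<lambda>z. u z * bump_kernel z) integrable_on cbox (-1) 1"
  by (intro integrable_continuous continuous_intros continuous_on_bump_kernel)

lemma bump_average_add:
  "continuous_on (cbox (-1) 1) u \<Longrightarrow> continuous_on (cbox (-1) 1) v \<Longrightarrow>
   bump_average (\<lambda>z. u z + v z) = bump_average u + bump_average v"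
  by (simp add: bump_average_def distrib_right integral_add integrable_times_bump_kernel add_divide_distrib)

lemma bump_average_cmult: "bump_average (\<lambda>z. r * u z) = r * bump_average u"
  by (simp add: bump_average_def mult.assoc)

lemma bump_average_const: "bump_average (\<lambda>z. r) = r"
  using bump_kernel_mass_pos[where 'n='a] by (simp add: bump_average_def)

lemma bump_average_mono:
  assumes "continuous_on (cbox (-1) 1) u" "continuous_on (cbox (-1) 1) v"
    and "\<And>z. z \<in> cbox (-1) 1 \<Longrightarrow> u z \<le> v z"
  shows "bump_average u \<le> bump_average v"
  unfolding bump_average_def using bump_kernel_mass_pos
  by (intro divide_right_mono integral_le integrable_times_bump_kernel mult_right_mono
        bump_kernel_nonneg assms) (auto intro: less_imp_le)

lemma bump_average_near_const:
  fixes u :: "real^'n \<Rightarrow> real"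
  assumes "continuous_on (cbox (-1) 1) u"
    and "\<And>z. z \<in> cbox (-1) 1 \<Longrightarrow> \<bar>u z - r\<bar> \<le> e"
  shows "\<bar>bump_average u - r\<bar> \<le> e"
proof -
  have bounds: "u z \<le> r + e" "r - e \<le> u z" if "z \<in> cbox (-1) 1" for z
    using assms(2)[OF that] by linarith+
  have "bump_average u \<le> bump_average (\<lambda>z::real^'n. r + e)"
    by (rule bump_average_mono[OF assms(1) continuous_on_const bounds(1)])
  moreover have "bump_average (\<lambda>z::real^'n. r - e) \<le> bump_average u"
    by (rule bump_average_mono[OF continuous_on_const assms(1) bounds(2)])
  ultimately show ?thesis by (simp add: bump_average_const abs_le_iff)
qed

text \<open>After the substitution \<open>y = x - \<epsilon> z\<close> a convolution over a box becomes an average over the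
  cube of translates of \<open>\<Phi>\<close>. The first form shows smoothness in \<open>x\<close>; the second shows that
  every linear inequality between translates of \<open>\<Phi>\<close> survives.\<close>

lemma smooth_bump_average:
  fixes \<Phi> :: "real^'n \<Rightarrow> real"
  assumes \<Phi>: "continuous_on (cbox p q) \<Phi>" and "0 < \<epsilon>"
  shows "\<exists>g. (\<forall>m. C_diff_on m UNIV g) \<and>
    (\<forall>x. (\<forall>k. p $ k + \<epsilon> \<le> x $ k \<and> x $ k \<le> q $ k - \<epsilon>) \<longrightarrow>
         g x = bump_average (\<lambda>z. \<Phi> (x - \<epsilon> *\<^sub>R z)))"
proof -
  define Z where "Z = integral (cbox (-1) 1) (bump_kernel :: real^'n \<Rightarrow> real)"
  have Z: "Z > 0" unfolding Z_def by (rule bump_kernel_mass_pos)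
  \<comment> \<open>The substitution has Jacobian \<open>\<epsilon> ^ CARD('n)\<close>; absorbing it and the kernel mass into \<open>F\<close> leaves
    the convolution without a scalar factor.\<close>
  define F where "F y = \<Phi> y / (Z * \<epsilon> ^ CARD('n))" for y
  define f where "f = (\<lambda>(k::'n) t. bump ((1 / \<epsilon>) * t))"
  have F: "continuous_on (cbox p q) F"
    unfolding F_def using \<Phi> Z \<open>0 < \<epsilon>\<close> by (intro continuous_intros) auto
  have f: "times_differentiable m (f k)" for m k
    unfolding f_def by (rule times_differentiable_bump)
  have "box_conv p q F f x = bump_average (\<lambda>z. \<Phi> (x - \<epsilon> *\<^sub>R z))"
    if x: "\<forall>k. p $ k + \<epsilon> \<le> x $ k \<and> x $ k \<le> q $ k - \<epsilon>" for x
  proof -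
    let ?w = "\<lambda>z. F (x - \<epsilon> *\<^sub>R z) * bump_kernel z"
    let ?image = "(\<lambda>y. (1 / - \<epsilon>) *\<^sub>R y + - ((1 / - \<epsilon>) *\<^sub>R x)) ` cbox p q"
    have w: "?w z = F (- \<epsilon> *\<^sub>R z + x) * (\<Prod>k\<in>UNIV. f k (x $ k - (- \<epsilon> *\<^sub>R z + x) $ k))" for z
      using \<open>0 < \<epsilon>\<close> by (simp add: bump_kernel_def f_def)
    have in_box: "x - \<epsilon> *\<^sub>R z \<in> cbox p q" if "z \<in> cbox (-1) 1" for z
      unfolding mem_box_cart
    proof
      fix k
      have "\<bar>\<epsilon> * z $ k\<bar> \<le> \<epsilon> * 1"
        unfolding abs_mult using that \<open>0 < \<epsilon>\<close>
        by (intro mult_mono) (auto simp: mem_box_cart abs_le_iff minus_le_iff)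
      then show "p $ k \<le> (x - \<epsilon> *\<^sub>R z) $ k \<and> (x - \<epsilon> *\<^sub>R z) $ k \<le> q $ k"
        using x[rule_format, of k] by (auto simp: abs_le_iff)
    qed
    have "continuous_on UNIV (f k)" for k
      using f[of 0] by simp
    from continuous_on_compose2[OF continuous_on_product_kernel[where f = f and I = UNIV, OF F this]
        continuous_on_Pair[OF continuous_on_const continuous_on_id], of x "cbox p q"]
    have "(\<lambda>y. F y * (\<Prod>k\<in>UNIV. f k (x $ k - y $ k))) integrable_on cbox p q"
      by (intro integrable_continuous) (auto simp: case_prod_beta)
    then have "((\<lambda>y. F y * (\<Prod>k\<in>UNIV. f k (x $ k - y $ k))) has_integral box_conv p q F f x) (cbox p q)"
      unfolding box_conv_def by (rule integrable_integral)
    from has_integral_affinity[OF this, of "- \<epsilon>" x]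
    have scaled: "(?w has_integral box_conv p q F f x / \<epsilon> ^ CARD('n)) ?image"
      using \<open>0 < \<epsilon>\<close> unfolding w by simp
    have "cbox (-1) 1 \<subseteq> ?image"
    proof
      fix z :: "real^'n" assume "z \<in> cbox (-1) 1"
      moreover have "z = (1 / - \<epsilon>) *\<^sub>R (x - \<epsilon> *\<^sub>R z) + - ((1 / - \<epsilon>) *\<^sub>R x)"
        using \<open>0 < \<epsilon>\<close> by (simp add: algebra_simps)
      ultimately show "z \<in> ?image" using in_box by blast
    qed
    moreover have cw: "continuous_on (cbox (-1) 1) (\<lambda>z. F (x - \<epsilon> *\<^sub>R z))"
      by (rule continuous_on_compose2[OF F]) (auto intro!: continuous_intros in_box)
    ultimately have "(?w has_integral integral (cbox (-1) 1) ?w) ?image"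
      by (intro has_integral_on_superset[OF integrable_integral[OF integrable_times_bump_kernel]])
        (auto simp: bump_kernel_eq_0)
    with scaled have "box_conv p q F f x / \<epsilon> ^ CARD('n) = integral (cbox (-1) 1) ?w"
      by (rule has_integral_unique)
    then have "box_conv p q F f x = \<epsilon> ^ CARD('n) * integral (cbox (-1) 1) ?w"
      using \<open>0 < \<epsilon>\<close> by (simp add: field_simps)
    also have "?w = (\<lambda>z. (1 / (Z * \<epsilon> ^ CARD('n))) * (\<Phi> (x - \<epsilon> *\<^sub>R z) * bump_kernel z))"
      by (simp add: F_def)
    finally show ?thesis
      using \<open>0 < \<epsilon>\<close> by (simp only: bump_average_def Z_def[symmetric] integral_mult_right) simp
  qed
  then show ?thesis
    by (intro exI[of _ "box_conv p q F f"] conjI allI impI C_diff_on_box_conv[OF F f])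
qed

section \<open>Increments of box monotone convex functions\<close>

lemma open_box_order_convex:
  assumes "open_box C" "x \<in> C" "y \<in> C" "x \<le> z" "z \<le> y"
  shows "z \<in> C"
proof -
  obtain a b where C: "C = {x. \<forall>k. a k < ereal (x $ k) \<and> ereal (x $ k) < b k}"
    using assms(1) by (auto simp: open_box_def)
  have "a k < ereal (z $ k) \<and> ereal (z $ k) < b k" for k
    using assms(2-5) unfolding C less_eq_vec_def
    by (auto intro: less_le_trans[of "a k" "ereal (x $ k)"] le_less_trans[of _ "ereal (y $ k)"])
  then show ?thesis by (simp add: C)
qed

lemma open_open_box: "open_box C \<Longrightarrow> open C"
  by (auto simp: open_box_def Collect_all_eq
      intro!: open_INT open_Collect_conj open_Collect_less continuous_intros)

lemma open_box_enlarge: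
  fixes c d :: "real^'n"
  assumes "open_box C" "c \<in> C" "d \<in> C"
  shows "\<exists>\<delta>>0. cbox (c - \<delta> *\<^sub>R 1) (d + \<delta> *\<^sub>R 1) \<subseteq> C"
proof -
  have "\<forall>\<^sub>F \<delta> in at_right 0. c - \<delta> *\<^sub>R 1 \<in> C"
    by (rule topological_tendstoD[of _ "c - 0 *\<^sub>R 1"], intro tendsto_intros)
      (use assms open_open_box in auto)
  moreover have "\<forall>\<^sub>F \<delta> in at_right 0. d + \<delta> *\<^sub>R 1 \<in> C"
    by (rule topological_tendstoD[of _ "d + 0 *\<^sub>R 1"], intro tendsto_intros)
      (use assms open_open_box in auto)
  moreover have "\<forall>\<^sub>F \<delta>::real in at_right 0. 0 < \<delta>"
    by (simp add: eventually_at_filter)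
  ultimately have "\<forall>\<^sub>F \<delta> in at_right 0. 0 < \<delta> \<and> c - \<delta> *\<^sub>R 1 \<in> C \<and> d + \<delta> *\<^sub>R 1 \<in> C"
    by eventually_elim simp
  then obtain \<delta> where "0 < \<delta>" "c - \<delta> *\<^sub>R 1 \<in> C" "d + \<delta> *\<^sub>R 1 \<in> C"
    using eventually_happens'[OF trivial_limit_at_right_real] by blast
  moreover from this have "x \<in> C" if "x \<in> cbox (c - \<delta> *\<^sub>R 1) (d + \<delta> *\<^sub>R 1)" for x
    by (intro open_box_order_convex[OF assms(1), of "c - \<delta> *\<^sub>R 1" "d + \<delta> *\<^sub>R 1" x])
      (use that in \<open>auto simp: mem_box_cart less_eq_vec_def\<close>)
  ultimately show ?thesis by blast
qed

text \<open>The two inner points divide the segment in proportions \<open>r\<close> and \<open>1 - r\<close>, so the two chord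
  inequalities add up with the weights cancelling.\<close>

lemma convex_on_increment_parallel:
  fixes e :: "'a::real_vector"
  assumes "convex_on C \<Phi>" "0 < s" "0 < t" "x \<in> C" "x + (s + t) *\<^sub>R e \<in> C"
  shows "\<Phi> (x + t *\<^sub>R e) - \<Phi> x \<le> \<Phi> (x + (s + t) *\<^sub>R e) - \<Phi> (x + s *\<^sub>R e)"
proof -
  have "\<Phi> (x + (r * (s + t)) *\<^sub>R e) \<le> (1 - r) * \<Phi> x + r * \<Phi> (x + (s + t) *\<^sub>R e)"
    if "0 \<le> r" "r \<le> 1" for r
    using convex_onD[OF assms(1) that assms(4,5)] by (simp add: algebra_simps)
  note chord = this
  define r where "r = t / (s + t)"
  have "0 \<le> r" "r \<le> 1" "r * (s + t) = t" "(1 - r) * (s + t) = s"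
    using assms(2,3) by (auto simp: r_def field_simps)
  with chord[of r] chord[of "1 - r"]
  have "\<Phi> (x + t *\<^sub>R e) \<le> (1 - r) * \<Phi> x + r * \<Phi> (x + (s + t) *\<^sub>R e)"
    "\<Phi> (x + s *\<^sub>R e) \<le> r * \<Phi> x + (1 - r) * \<Phi> (x + (s + t) *\<^sub>R e)"
    by simp_all
  then show ?thesis
    by (simp add: left_diff_distrib)
qed

text \<open>Box monotonicity says precisely that the increment in direction \<open>k\<close> grows in every other
  coordinate, and convexity that it grows in coordinate \<open>k\<close>.\<close>

lemma increment_mono_coordinate:
  fixes \<Phi> :: "real^'n \<Rightarrow> real"
  assumes "open_box C" "two_box_monotone_on C \<Phi>" "convex_on C \<Phi>" "0 < s" "0 < t"
    and x: "x \<in> C" "x + s *\<^sub>R axis j 1 + t *\<^sub>R axis k 1 \<in> C"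
  shows "\<Phi> (x + t *\<^sub>R axis k 1) - \<Phi> x \<le>
         \<Phi> (x + s *\<^sub>R axis j 1 + t *\<^sub>R axis k 1) - \<Phi> (x + s *\<^sub>R axis j 1)"
proof (cases "j = k")
  case True
  with convex_on_increment_parallel[OF assms(3-5) x(1), of "axis k 1"] x(2)
  show ?thesis by (simp add: scaleR_add_left add.assoc)
next
  case False
  have "{set2 x j s' k t' | s' t'. s' \<in> {x $ j..x $ j + s} \<and> t' \<in> {x $ k..x $ k + t}} \<subseteq> C"
    using \<open>j \<noteq> k\<close>
    by (auto intro!: open_box_order_convex[OF assms(1) x] simp: less_eq_vec_def set2_def axis_def)
  moreover have "set2 x j (x $ j) k (x $ k) = x"
    "set2 x j (x $ j + s) k (x $ k) = x + s *\<^sub>R axis j 1"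
    "set2 x j (x $ j) k (x $ k + t) = x + t *\<^sub>R axis k 1"
    "set2 x j (x $ j + s) k (x $ k + t) = x + s *\<^sub>R axis j 1 + t *\<^sub>R axis k 1"
    using \<open>j \<noteq> k\<close> by (auto simp: set2_def axis_def vec_eq_iff)
  ultimately show ?thesis
    using assms(2)[unfolded two_box_monotone_on_def, rule_format,
        of j k "x $ j" "x $ j + s" "x $ k" "x $ k + t" x] \<open>j \<noteq> k\<close> assms(4,5) by simp
qed

text \<open>Changing one coordinate at a time leads from \<open>x\<close> to \<open>y\<close> through points of the box.\<close>

lemma increment_mono:
  fixes \<Phi> :: "real^'n \<Rightarrow> real"
  assumes "open_box C" "two_box_monotone_on C \<Phi>" "convex_on C \<Phi>" "0 < t"
    and xy: "x \<in> C" "y + t *\<^sub>R axis k 1 \<in> C" "x \<le> y"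
  shows "\<Phi> (x + t *\<^sub>R axis k 1) - \<Phi> x \<le> \<Phi> (y + t *\<^sub>R axis k 1) - \<Phi> y"
proof -
  \<comment> \<open>The path from \<open>x\<close> to \<open>y\<close> that switches the coordinates in \<open>S\<close>; every point on it and its
    increment lies between \<open>x\<close> and \<open>y + t e\<^sub>k\<close>, hence in the domain.\<close>
  define z where "z S = (\<chi> j. if j \<in> S then y $ j else x $ j)" for S
  have z_in: "w \<in> C" if "x \<le> w" "w \<le> y + t *\<^sub>R axis k 1" for w
    using open_box_order_convex[OF assms(1) xy(1,2)] that by blast
  have z_le: "x \<le> z S" "z S + t *\<^sub>R axis k 1 \<le> y + t *\<^sub>R axis k 1" for S
    using xy(3) by (auto simp: z_def less_eq_vec_def)
  have z_le': "z S \<le> y + t *\<^sub>R axis k 1" "x \<le> z S + t *\<^sub>R axis k 1" for S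
    using xy(3) \<open>0 < t\<close> by (auto simp: z_def less_eq_vec_def axis_def intro: add_increasing2)
  have "\<Phi> (x + t *\<^sub>R axis k 1) - \<Phi> x \<le> \<Phi> (z S + t *\<^sub>R axis k 1) - \<Phi> (z S)"
    if "finite S" for S
    using that
  proof (induction S)
    case empty
    show ?case by (simp add: z_def)
  next
    case (insert j S)
    have z_insert: "z (insert j S) = z S + (y $ j - x $ j) *\<^sub>R axis j 1"
      using insert.hyps by (auto simp: z_def vec_eq_iff axis_def)
    show ?case
    proof (cases "x $ j = y $ j")
      case True
      then show ?thesis using insert.IH z_insert by simp
    next
      case False
      with xy(3) have "0 < y $ j - x $ j" by (simp add: less_eq_vec_def order_less_le)
      from increment_mono_coordinate[OF assms(1-3) this \<open>0 < t\<close>, of "z S" j k]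
      have "\<Phi> (z S + t *\<^sub>R axis k 1) - \<Phi> (z S) \<le>
          \<Phi> (z (insert j S) + t *\<^sub>R axis k 1) - \<Phi> (z (insert j S))"
        unfolding z_insert[symmetric]
        using z_in[OF z_le(1) z_le'(1)] z_in[OF z_le'(2) z_le(2)] by blast
      with insert.IH show ?thesis by linarith
    qed
  qed
  from this[of UNIV] show ?thesis by (simp add: z_def)
qed

section \<open>Differentials and the quadratic correction\<close>

text \<open>Only a one-sided difference quotient is compared, and it may leave \<open>S\<close>: at an upper endpoint of
  a box, or on a degenerate box, there is no room inside for a positive increment.\<close>

lemma isotone_differential_onI:
  fixes g :: "real^'n \<Rightarrow> real"
  assumes diff: "\<And>x. x \<in> S \<Longrightarrow> g differentiable (at x)" and "0 < \<delta>"
    and incr: "\<And>x y t k. x \<in> S \<Longrightarrow> y \<in> S \<Longrightarrow> x \<le> y \<Longrightarrow> 0 < t \<Longrightarrow> t < \<delta> \<Longrightarrow>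
            g (x + t *\<^sub>R axis k 1) - g x \<le> g (y + t *\<^sub>R axis k 1) - g y"
  shows "isotone_differential_on S g"
proof -
  have lim: "((\<lambda>t. (g (x + t *\<^sub>R axis k 1) - g x) / t) \<longlongrightarrow> partial_deriv k g x) (at_right 0)"
    if "x \<in> S" for x k
  proof -
    have "(g has_derivative frechet_derivative g (at x)) (at x)"
      using diff[OF that] by (simp add: frechet_derivative_works)
    moreover have "((\<lambda>t. x + t *\<^sub>R axis k 1) has_derivative (\<lambda>t. t *\<^sub>R axis k 1)) (at 0)"
      by (auto intro!: derivative_eq_intros)
    ultimately have "((\<lambda>t. g (x + t *\<^sub>R axis k 1)) has_derivative
        (\<lambda>t. frechet_derivative g (at x) (t *\<^sub>R axis k 1))) (at 0)"
      using has_derivative_compose[of "\<lambda>t. x + t *\<^sub>R axis k 1" _ 0 UNIV g] by simp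
    moreover have "frechet_derivative g (at x) (t *\<^sub>R axis k 1) = partial_deriv k g x * t" for t
      using linear_frechet_derivative[OF diff[OF that]]
      by (simp add: partial_deriv_def linear_cmul mult.commute)
    ultimately have "((\<lambda>t. g (x + t *\<^sub>R axis k 1)) has_real_derivative partial_deriv k g x) (at 0)"
      by (simp add: has_field_derivative_def)
    then show ?thesis
      by (simp add: DERIV_def filterlim_at_split)
  qed
  have "partial_deriv k g x \<le> partial_deriv k g y" if "x \<in> S" "y \<in> S" "x \<le> y" for x y k
  proof (rule tendsto_le[OF trivial_limit_at_right_real lim[OF that(2)] lim[OF that(1)]])
    have "\<forall>\<^sub>F t in at_right 0. t < \<delta>"
      using \<open>0 < \<delta>\<close> by (auto intro: order_tendstoD)
    moreover have "\<forall>\<^sub>F t::real in at_right 0. 0 < t"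
      by (simp add: eventually_at_filter)
    ultimately show "\<forall>\<^sub>F t in at_right 0. (g (x + t *\<^sub>R axis k 1) - g x) / t
                         \<le> (g (y + t *\<^sub>R axis k 1) - g y) / t"
      by eventually_elim (auto intro!: divide_right_mono incr that)
  qed
  with diff show ?thesis
    by (auto simp: isotone_differential_on_def intro!: mono_onI)
qed

lemma C_diff_on_add:
  fixes g h :: "real^'n \<Rightarrow> real"
  shows "C_diff_on m UNIV g \<Longrightarrow> C_diff_on m UNIV h \<Longrightarrow> C_diff_on m UNIV (\<lambda>x. g x + h x)"
proof (induction m arbitrary: g h)
  case 0
  then show ?case by (auto intro: continuous_intros)
next
  case (Suc m)
  then have diff: "g differentiable (at x)" "h differentiable (at x)" for x
    by auto
  have "partial_deriv k (\<lambda>x. g x + h x) x = partial_deriv k g x + partial_deriv k h x" for k x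
    using frechet_derivative_at[OF has_derivative_add[OF
        diff(1)[of x, unfolded frechet_derivative_works] diff(2)[of x, unfolded frechet_derivative_works]]]
    by (simp add: partial_deriv_def fun_eq_iff)
  then have "partial_deriv k (\<lambda>x. g x + h x) = (\<lambda>x. partial_deriv k g x + partial_deriv k h x)" for k
    by blast
  moreover have "C_diff_on m UNIV (\<lambda>x. partial_deriv k g x + partial_deriv k h x)" for k
    using Suc.prems by (intro Suc.IH) simp_all
  ultimately show ?case
    using differentiable_add[OF diff] by simp
qed

text \<open>Linear and constant terms are included because they are what differentiation makes of the
  square of the norm.\<close>

lemma C_diff_on_quadratic:
  fixes v :: "real^'n"
  shows "C_diff_on m UNIV (\<lambda>x. r * (norm x)\<^sup>2 + v \<bullet> x + s)"
proof (induction m arbitrary: r v s)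
  case 0
  show ?case by (auto intro!: continuous_intros)
next
  case (Suc m)
  have D: "((\<lambda>x. r * (norm x)\<^sup>2 + v \<bullet> x + s) has_derivative (\<lambda>h. r * (2 * (x \<bullet> h)) + v \<bullet> h)) (at x)" for x
    unfolding power2_norm_eq_inner
    by (auto intro!: derivative_eq_intros simp: inner_commute algebra_simps)
  have "partial_deriv k (\<lambda>x. r * (norm x)\<^sup>2 + v \<bullet> x + s) =
      (\<lambda>x. 0 * (norm x)\<^sup>2 + (2 * r) *\<^sub>R axis k 1 \<bullet> x + v $ k)" for k
    by (rule ext) (simp add: partial_deriv_def frechet_derivative_at[OF D, symmetric] inner_axis inner_axis')
  then have "C_diff_on m UNIV (partial_deriv k (\<lambda>x. r * (norm x)\<^sup>2 + v \<bullet> x + s))" for k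
    by (simp only: Suc.IH)
  moreover have "(\<lambda>x. r * (norm x)\<^sup>2 + v \<bullet> x + s) differentiable (at x)" for x
    by (rule differentiableI[OF D])
  ultimately show ?case by simp
qed

section \<open>The approximation\<close>

text \<open>The same approximant serves both parts of the theorem: isotonicity of \<open>\<Phi>\<close> is one more
  inequality between translates that the average inherits.\<close>

lemma smooth_approximation:
  fixes \<Phi> :: "real^'n \<Rightarrow> real" and C :: "(real^'n) set" and c d :: "real^'n"
  assumes C: "open_box C" and box_mono: "two_box_monotone_on C \<Phi>" and conv: "convex_on C \<Phi>"
    and "c \<le> d" "cbox c d \<subseteq> C" and "0 < e"
  shows "\<exists>\<Psi>. smooth_on (cbox c d) \<Psi> \<and> strongly_convex_on (cbox c d) \<Psi> \<and>
           isotone_differential_on (cbox c d) \<Psi> \<and>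
           (C \<subseteq> {x. \<forall>k. 0 < x $ k} \<and> mono_on C \<Phi> \<longrightarrow> mono_on (cbox c d) \<Psi>) \<and>
           (\<forall>x\<in>cbox c d. \<bar>\<Psi> x - \<Phi> x\<bar> \<le> e)"
proof -
  have "c \<in> C" "d \<in> C"
    using \<open>c \<le> d\<close> by (auto simp: mem_box_cart less_eq_vec_def intro!: subsetD[OF \<open>cbox c d \<subseteq> C\<close>])
  then obtain \<delta>\<^sub>0 where "0 < \<delta>\<^sub>0" and \<delta>\<^sub>0: "cbox (c - \<delta>\<^sub>0 *\<^sub>R 1) (d + \<delta>\<^sub>0 *\<^sub>R 1) \<subseteq> C"
    using open_box_enlarge[OF C] by blast
  \<comment> \<open>One half of the margin is for the translates in the average, the other for the increments
    that test the derivative at boundary points of the compact box.\<close>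
  define \<delta> where "\<delta> = \<delta>\<^sub>0 / 2"
  define p where "p = c - \<delta>\<^sub>0 *\<^sub>R 1"
  define q where "q = d + \<delta>\<^sub>0 *\<^sub>R 1"
  define B where "B = cbox (c - \<delta> *\<^sub>R 1) (d + \<delta> *\<^sub>R 1)"
  have "0 < \<delta>" using \<open>0 < \<delta>\<^sub>0\<close> by (simp add: \<delta>_def)
  have pq: "cbox p q \<subseteq> C" using \<delta>\<^sub>0 by (simp add: p_def q_def)
  have K_B: "x \<in> B" if "x \<in> cbox c d" for x
    unfolding B_def mem_box_cart
  proof
    fix k
    show "(c - \<delta> *\<^sub>R 1) $ k \<le> x $ k \<and> x $ k \<le> (d + \<delta> *\<^sub>R 1) $ k"
      using that[unfolded mem_box_cart, rule_format, of k] \<open>0 < \<delta>\<close> by simp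
  qed
  have step_B: "x + t *\<^sub>R axis j 1 \<in> B" if "x \<in> cbox c d" "0 < t" "t < \<delta>" for x t j
    unfolding B_def mem_box_cart
  proof
    fix k
    show "(c - \<delta> *\<^sub>R 1) $ k \<le> (x + t *\<^sub>R axis j 1) $ k \<and> (x + t *\<^sub>R axis j 1) $ k \<le> (d + \<delta> *\<^sub>R 1) $ k"
      using that(1)[unfolded mem_box_cart, rule_format, of k] that(2,3) by (auto simp: axis_def)
  qed
  have cont: "continuous_on (cbox p q) \<Phi>"
    by (rule continuous_on_subset[OF convex_on_continuous[OF open_open_box[OF C] conv] pq])
  then have "uniformly_continuous_on (cbox p q) \<Phi>"
    by (rule compact_uniformly_continuous) (rule compact_cbox)
  then obtain r where "0 < r"
    and r: "\<And>x y. x \<in> cbox p q \<Longrightarrow> y \<in> cbox p q \<Longrightarrow> dist y x < r \<Longrightarrow> dist (\<Phi> y) (\<Phi> x) < e / 2"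
    by (rule uniformly_continuous_onE[OF _ half_gt_zero[OF \<open>0 < e\<close>]]) (rule that)
  \<comment> \<open>Points of the cube have norm at most \<open>CARD('n)\<close>, so translates by \<open>\<epsilon> z\<close> move less than \<open>r\<close>.\<close>
  define \<epsilon> where "\<epsilon> = min \<delta> (r / (2 * real CARD('n)))"
  have "0 < \<epsilon>" "\<epsilon> \<le> \<delta>"
    using \<open>0 < \<delta>\<close> \<open>0 < r\<close> by (auto simp: \<epsilon>_def)
  have small: "norm (\<epsilon> *\<^sub>R z) < r" if "z \<in> cbox (-1) (1 :: real^'n)" for z
  proof -
    have "\<bar>z $ k\<bar> \<le> 1" for k
      using that[unfolded mem_box_cart, rule_format, of k] by auto
    then have "norm z \<le> real CARD('n)"
      using norm_le_l1_cart[of z] sum_bounded_above[of UNIV "\<lambda>k. \<bar>z $ k\<bar>" 1] by simp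
    then have "\<epsilon> * norm z \<le> r / (2 * real CARD('n)) * real CARD('n)"
      using \<open>0 < \<epsilon>\<close> by (intro mult_mono) (auto simp: \<epsilon>_def)
    also have "\<dots> < r" using \<open>0 < r\<close> by simp
    finally show ?thesis using \<open>0 < \<epsilon>\<close> by simp
  qed
  have shift: "x - \<epsilon> *\<^sub>R z \<in> cbox p q" if "x \<in> B" "z \<in> cbox (-1) 1" for x z :: "real^'n"
    unfolding mem_box_cart
  proof
    fix k
    have "\<bar>z $ k\<bar> \<le> 1"
      using that(2)[unfolded mem_box_cart, rule_format, of k] by auto
    then have "\<bar>\<epsilon> * z $ k\<bar> \<le> \<delta> * 1"
      unfolding abs_mult using \<open>0 < \<epsilon>\<close> \<open>\<epsilon> \<le> \<delta>\<close> by (intro mult_mono) auto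
    then show "p $ k \<le> (x - \<epsilon> *\<^sub>R z) $ k \<and> (x - \<epsilon> *\<^sub>R z) $ k \<le> q $ k"
      using that(1)[unfolded B_def mem_box_cart, rule_format, of k]
      by (auto simp: p_def q_def \<delta>_def abs_le_iff)
  qed
  have shift_C: "x - \<epsilon> *\<^sub>R z \<in> C" if "x \<in> B" "z \<in> cbox (-1) 1" for x z
    using shift[OF that] pq by blast
  have shift_cont: "continuous_on (cbox (-1) 1) (\<lambda>z. \<Phi> (x - \<epsilon> *\<^sub>R z))" if "x \<in> B" for x
    by (rule continuous_on_compose2[OF cont]) (auto intro!: continuous_intros shift that)
  obtain g where g_smooth: "\<And>m. C_diff_on m UNIV g"
    and g': "\<And>x. (\<forall>k. p $ k + \<epsilon> \<le> x $ k \<and> x $ k \<le> q $ k - \<epsilon>) \<Longrightarrow>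
                g x = bump_average (\<lambda>z. \<Phi> (x - \<epsilon> *\<^sub>R z))"
    using smooth_bump_average[OF cont \<open>0 < \<epsilon>\<close>] by blast
  have g: "g x = bump_average (\<lambda>z. \<Phi> (x - \<epsilon> *\<^sub>R z))" if "x \<in> B" for x
  proof (rule g', rule)
    fix k
    show "p $ k + \<epsilon> \<le> x $ k \<and> x $ k \<le> q $ k - \<epsilon>"
      using that[unfolded B_def mem_box_cart, rule_format, of k] \<open>\<epsilon> \<le> \<delta>\<close>
      by (auto simp: p_def q_def \<delta>_def)
  qed

  have g_near: "\<bar>g x - \<Phi> x\<bar> \<le> e / 2" if "x \<in> cbox c d" for x
  proof -
    have "x \<in> B" by (rule K_B[OF that])
    then have x: "x \<in> cbox p q" using shift[of x 0] by (simp add: mem_box_cart)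
    show ?thesis
      unfolding g[OF \<open>x \<in> B\<close>]
    proof (rule bump_average_near_const[OF shift_cont[OF \<open>x \<in> B\<close>]])
      fix z :: "real^'n" assume "z \<in> cbox (-1) 1"
      with r[OF x shift[OF \<open>x \<in> B\<close>]] small show "\<bar>\<Phi> (x - \<epsilon> *\<^sub>R z) - \<Phi> x\<bar> \<le> e / 2"
        by (simp add: dist_norm less_imp_le)
    qed
  qed
  have g_convex: "convex_on (cbox c d) g"
  proof (rule convex_onI)
    fix t :: real and x y
    assume t: "0 < t" "t < 1" and xy: "x \<in> cbox c d" "y \<in> cbox c d"
    have "(1 - t) *\<^sub>R x + t *\<^sub>R y \<in> cbox c d"
      by (rule convexD_alt[OF convex_box(1) xy]) (use t in auto)
    note B = K_B[OF xy(1)] K_B[OF xy(2)] K_B[OF this]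
    have "bump_average (\<lambda>z. \<Phi> ((1 - t) *\<^sub>R x + t *\<^sub>R y - \<epsilon> *\<^sub>R z))
      \<le> bump_average (\<lambda>z. (1 - t) * \<Phi> (x - \<epsilon> *\<^sub>R z) + t * \<Phi> (y - \<epsilon> *\<^sub>R z))"
    proof (intro bump_average_mono shift_cont B continuous_intros)
      fix z :: "real^'n" assume z: "z \<in> cbox (-1) 1"
      have "(1 - t) *\<^sub>R x + t *\<^sub>R y - \<epsilon> *\<^sub>R z = (1 - t) *\<^sub>R (x - \<epsilon> *\<^sub>R z) + t *\<^sub>R (y - \<epsilon> *\<^sub>R z)"
        by (simp add: algebra_simps)
      then show "\<Phi> ((1 - t) *\<^sub>R x + t *\<^sub>R y - \<epsilon> *\<^sub>R z)
          \<le> (1 - t) * \<Phi> (x - \<epsilon> *\<^sub>R z) + t * \<Phi> (y - \<epsilon> *\<^sub>R z)"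
        using convex_onD[OF conv _ _ shift_C[OF B(1) z] shift_C[OF B(2) z], of t] t by simp
    qed
    also have "\<dots> = (1 - t) * bump_average (\<lambda>z. \<Phi> (x - \<epsilon> *\<^sub>R z)) + t * bump_average (\<lambda>z. \<Phi> (y - \<epsilon> *\<^sub>R z))"
      unfolding bump_average_cmult[symmetric]
      by (rule bump_average_add) (intro continuous_intros shift_cont B)+
    finally show "g ((1 - t) *\<^sub>R x + t *\<^sub>R y) \<le> (1 - t) * g x + t * g y"
      by (simp only: g B)
  qed (rule convex_box)
  have g_incr: "g (x + t *\<^sub>R axis k 1) - g x \<le> g (y + t *\<^sub>R axis k 1) - g y"
    if xy: "x \<in> cbox c d" "y \<in> cbox c d" "x \<le> y" and t: "0 < t" "t < \<delta>" for x y t k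
  proof -
    note B = K_B[OF xy(1)] K_B[OF xy(2)] step_B[OF xy(1) t, of k] step_B[OF xy(2) t, of k]
    have "bump_average (\<lambda>z. \<Phi> (x + t *\<^sub>R axis k 1 - \<epsilon> *\<^sub>R z) + \<Phi> (y - \<epsilon> *\<^sub>R z))
       \<le> bump_average (\<lambda>z. \<Phi> (y + t *\<^sub>R axis k 1 - \<epsilon> *\<^sub>R z) + \<Phi> (x - \<epsilon> *\<^sub>R z))"
    proof (intro bump_average_mono shift_cont B continuous_intros)
      fix z :: "real^'n" assume z: "z \<in> cbox (-1) 1"
      have swap: "w + t *\<^sub>R axis k 1 - \<epsilon> *\<^sub>R z = w - \<epsilon> *\<^sub>R z + t *\<^sub>R axis k 1" for w
        by simp
      have "x - \<epsilon> *\<^sub>R z \<le> y - \<epsilon> *\<^sub>R z"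
        using xy(3) by (simp add: less_eq_vec_def)
      from increment_mono[OF C box_mono conv t(1) shift_C[OF B(1) z] _ this, of k]
        shift_C[OF B(4) z]
      show "\<Phi> (x + t *\<^sub>R axis k 1 - \<epsilon> *\<^sub>R z) + \<Phi> (y - \<epsilon> *\<^sub>R z)
          \<le> \<Phi> (y + t *\<^sub>R axis k 1 - \<epsilon> *\<^sub>R z) + \<Phi> (x - \<epsilon> *\<^sub>R z)"
        unfolding swap by linarith
    qed
    then have "g (x + t *\<^sub>R axis k 1) + g y \<le> g (y + t *\<^sub>R axis k 1) + g x"
      by (simp only: g B bump_average_add[OF shift_cont shift_cont])
    then show ?thesis by linarith
  qed
  have g_mono: "g x \<le> g y"
    if "mono_on C \<Phi>" and xy: "x \<in> cbox c d" "y \<in> cbox c d" "x \<le> y" for x y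
  proof -
    note B = K_B[OF xy(1)] K_B[OF xy(2)]
    have "bump_average (\<lambda>z. \<Phi> (x - \<epsilon> *\<^sub>R z)) \<le> bump_average (\<lambda>z. \<Phi> (y - \<epsilon> *\<^sub>R z))"
      using xy(3) by (intro bump_average_mono shift_cont B mono_onD[OF \<open>mono_on C \<Phi>\<close>] shift_C)
        (auto simp: less_eq_vec_def)
    then show ?thesis by (simp only: g B)
  qed

  obtain M where "0 < M" and M: "\<And>x. x \<in> cbox c d \<Longrightarrow> norm x \<le> M"
    using bounded_cbox[of c d] unfolding bounded_pos by blast
  \<comment> \<open>Chosen so that the quadratic term is at most \<open>e / 2\<close> on the compact box.\<close>
  define \<alpha> where "\<alpha> = e / M\<^sup>2"
  have "0 < \<alpha>" using \<open>0 < e\<close> \<open>0 < M\<close> by (simp add: \<alpha>_def)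
  define \<Psi> where "\<Psi> x = g x + \<alpha> / 2 * (norm x)\<^sup>2" for x
  have \<Psi>_smooth: "C_diff_on m UNIV \<Psi>" for m
    using C_diff_on_add[OF g_smooth C_diff_on_quadratic[of m "\<alpha> / 2" 0 0]]
    by (simp add: \<Psi>_def[abs_def])
  have "smooth_on (cbox c d) \<Psi>"
    unfolding smooth_on_def using \<Psi>_smooth by blast
  moreover have "strongly_convex_on (cbox c d) \<Psi>"
    unfolding strongly_convex_on_def \<Psi>_def using \<open>0 < \<alpha>\<close> g_convex
    by (intro exI[of _ \<alpha>]) simp
  moreover have "isotone_differential_on (cbox c d) \<Psi>"
  proof (rule isotone_differential_onI[OF _ \<open>0 < \<delta>\<close>])
    show "\<Psi> differentiable (at x)" for x
      using \<Psi>_smooth[of "Suc 0"] by simp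
  next
    fix x y t k
    assume xy: "x \<in> cbox c d" "y \<in> cbox c d" "x \<le> y" and t: "0 < t" "t < \<delta>"
    have sq: "(norm (w + t *\<^sub>R axis k 1))\<^sup>2 - (norm w)\<^sup>2 = 2 * t * w $ k + t\<^sup>2" for w :: "real^'n"
      unfolding power2_norm_eq_inner
      by (simp add: inner_add_left inner_add_right inner_axis inner_axis' power2_eq_square algebra_simps)
    have "x $ k \<le> y $ k" using xy(3) by (simp add: less_eq_vec_def)
    then have "(norm (x + t *\<^sub>R axis k 1))\<^sup>2 - (norm x)\<^sup>2 \<le> (norm (y + t *\<^sub>R axis k 1))\<^sup>2 - (norm y)\<^sup>2"
      unfolding sq using t(1) by simp
    then have "\<alpha> / 2 * ((norm (x + t *\<^sub>R axis k 1))\<^sup>2 - (norm x)\<^sup>2)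
        \<le> \<alpha> / 2 * ((norm (y + t *\<^sub>R axis k 1))\<^sup>2 - (norm y)\<^sup>2)"
      using \<open>0 < \<alpha>\<close> by (intro mult_left_mono) auto
    with g_incr[OF xy t, of k]
    show "\<Psi> (x + t *\<^sub>R axis k 1) - \<Psi> x \<le> \<Psi> (y + t *\<^sub>R axis k 1) - \<Psi> y"
      unfolding \<Psi>_def right_diff_distrib by linarith
  qed
  moreover have "mono_on (cbox c d) \<Psi>" if pos: "C \<subseteq> {x. \<forall>k. 0 < x $ k}" and mono: "mono_on C \<Phi>"
  proof (rule mono_onI)
    fix x y assume xy: "x \<in> cbox c d" "y \<in> cbox c d" "x \<le> y"
    have "0 \<le> x $ k" for k
      using xy(1) \<open>cbox c d \<subseteq> C\<close> pos by (auto intro: less_imp_le)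
    then have "norm x \<le> norm y"
      using xy(3) by (intro norm_le_componentwise_cart) (auto simp: less_eq_vec_def intro: order_trans)
    then have "\<alpha> / 2 * (norm x)\<^sup>2 \<le> \<alpha> / 2 * (norm y)\<^sup>2"
      using \<open>0 < \<alpha>\<close> by (intro mult_left_mono power_mono) auto
    with g_mono[OF mono xy] show "\<Psi> x \<le> \<Psi> y" by (simp add: \<Psi>_def)
  qed
  moreover have "\<bar>\<Psi> x - \<Phi> x\<bar> \<le> e" if "x \<in> cbox c d" for x
  proof -
    have "\<alpha> / 2 * (norm x)\<^sup>2 \<le> \<alpha> / 2 * M\<^sup>2"
      using \<open>0 < \<alpha>\<close> M[OF that] by (intro mult_left_mono power_mono) auto
    also have "\<dots> = e / 2" using \<open>0 < M\<close> by (simp add: \<alpha>_def)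
    finally have "\<bar>\<alpha> / 2 * (norm x)\<^sup>2\<bar> \<le> e / 2" using \<open>0 < \<alpha>\<close> by simp
    with g_near[OF that] show ?thesis unfolding \<Psi>_def by linarith
  qed
  ultimately show ?thesis by (intro exI[of _ \<Psi>]) simp
qed

theorem theorem3:
  fixes \<Phi> :: "real^'n \<Rightarrow> real" and C :: "(real^'n) set" and c d :: "real^'n"
  assumes "CARD('n) \<ge> 2"
    and "open_box C"
    and "two_box_monotone_on C \<Phi>"
    and "convex_on C \<Phi>"
    and "c \<le> d" and "cbox c d \<subseteq> C"
  shows "(\<exists>\<Phi>s :: nat \<Rightarrow> real^'n \<Rightarrow> real.
            uniform_limit (cbox c d) \<Phi>s \<Phi> sequentially \<and>
            (\<forall>n. smooth_on (cbox c d) (\<Phi>s n) \<and>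
                 strongly_convex_on (cbox c d) (\<Phi>s n) \<and>
                 isotone_differential_on (cbox c d) (\<Phi>s n)))
       \<and> (C \<subseteq> {x. \<forall>k. 0 < x $ k} \<and> mono_on C \<Phi> \<longrightarrow>
          (\<exists>\<Phi>s :: nat \<Rightarrow> real^'n \<Rightarrow> real.
            uniform_limit (cbox c d) \<Phi>s \<Phi> sequentially \<and>
            (\<forall>n. smooth_on (cbox c d) (\<Phi>s n) \<and>
                 strongly_convex_on (cbox c d) (\<Phi>s n) \<and>
                 isotone_differential_on (cbox c d) (\<Phi>s n) \<and>
                 mono_on (cbox c d) (\<Phi>s n))))"
proof -
  define good where "good n \<Psi> \<longleftrightarrow> smooth_on (cbox c d) \<Psi> \<and> strongly_convex_on (cbox c d) \<Psi> \<and>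
           isotone_differential_on (cbox c d) \<Psi> \<and>
           (C \<subseteq> {x. \<forall>k. 0 < x $ k} \<and> mono_on C \<Phi> \<longrightarrow> mono_on (cbox c d) \<Psi>) \<and>
           (\<forall>x\<in>cbox c d. \<bar>\<Psi> x - \<Phi> x\<bar> \<le> inverse (real (Suc n)))" for n \<Psi>
  have "\<forall>n. \<exists>\<Psi>. good n \<Psi>"
    unfolding good_def using smooth_approximation[OF assms(2-6)] by simp
  from choice[OF this] obtain \<Psi> where \<Psi>: "\<forall>n. good n (\<Psi> n)" ..
  have "uniform_limit (cbox c d) \<Psi> \<Phi> sequentially"
  proof (rule uniform_limitI)
    fix e :: real assume "0 < e"
    have "\<forall>\<^sub>F n in sequentially. inverse (real (Suc n)) < e"
      using order_tendstoD(2)[OF LIMSEQ_inverse_real_of_nat \<open>0 < e\<close>] .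
    then show "\<forall>\<^sub>F n in sequentially. \<forall>x\<in>cbox c d. dist (\<Psi> n x) (\<Phi> x) < e"
    proof eventually_elim
      case (elim n)
      have "\<bar>\<Psi> n x - \<Phi> x\<bar> \<le> inverse (real (Suc n))" if "x \<in> cbox c d" for x
        using \<Psi> that unfolding good_def by blast
      with elim show ?case unfolding dist_real_def by (blast intro: le_less_trans)
    qed
  qed
  moreover have "mono_on (cbox c d) (\<Psi> n)" if "C \<subseteq> {x. \<forall>k. 0 < x $ k} \<and> mono_on C \<Phi>" for n
    using \<Psi>[rule_format, of n] that unfolding good_def by blast
  moreover have "smooth_on (cbox c d) (\<Psi> n)" "strongly_convex_on (cbox c d) (\<Psi> n)"
      "isotone_differential_on (cbox c d) (\<Psi> n)" for n
    using \<Psi>[rule_format, of n] unfolding good_def by blast+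
  ultimately show ?thesis by blast
qed

end
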